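(* Let $k\ge 1$ be an integer, $\lambda>0$, and let $\{Z(t)\}_{t\ge 0}$ be the compound Poisson process of order $k$, $Z(t)=\sum_{i=1}^{N^{(k)}(t)}Y_i$, with distribution $CPPoK(\lambda,H)$, where $H$ has a density or probability mass function $h$. Let $n\ge 1$, $0=t_0\le t_1\le\dots\le t_n$, $\Delta t_l=t_l-t_{l-1}$ for $l=1,\dots,n$, and $p_j(t)=\mathbb{P}[N^{(k)}(t)=j]$ for $j=0,1,2,\ldots$. Then for all real $y_1,\dots,y_n$, $$\mathbb{P}[Z(t_1)\le y_1,\dots,Z(t_n)\le y_n]=\sum_{j_1,\dots,j_n\ge 0}\ \prod_{l=1}^n p_{j_l}(\Delta t_l)\int_{-\infty}^{v_1}\cdots\int_{-\infty}^{v_n}\ \prod_{m=1}^n h^{*j_m}(x_m)\,dx_m,$$ where the sum is over all non-negative integers $j_1,\dots,j_n$, $v_m=y_m-\sum_{l=1}^{m-1}x_l$ for $m=1,\dots,n$ (so the integral is an iterated integral with $x_1$ outermost and $x_n$ innermost), and $h^{*j}$ is the $j$-fold convolution of $h$.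
   Context: Poisson process of order $k$, $PPoK(\lambda)$: $N^{(k)}(t)=\sum_{i=1}^{N(t)}X_i$, where $\{N(t)\}_{t\ge0}$ is a Poisson process with rate $k\lambda$ and $\{X_i\}_{i\ge1}$ are i.i.d. discrete uniform on $\{1,\dots,k\}$, independent of $\{N(t)\}$. Compound Poisson process of order $k$, $CPPoK(\lambda,H)$: $Z(t)=\sum_{i=1}^{N^{(k)}(t)}Y_i$, where $\{N^{(k)}(t)\}_{t\ge0}$ is $PPoK(\lambda)$ and $\{Y_i\}_{i\ge1}$ are i.i.d. real random variables with cumulative distribution function $H$, independent of $\{N^{(k)}(t)\}$ (empty sums are $0$). Convention: $h^{*j}(x)\,dx$ denotes the law of $Y_1+\dots+Y_j$; for $j=0$ it is the Dirac mass at $0$; in the case of a probability mass function, integrals are read as sums. *)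

theory Defs
  imports "HOL-Probability.Probability"
begin

text \<open>The sub-\<open>\<sigma>\<close>-algebra of \<open>M\<close> generated by the random variables \<open>X i\<close>, \<open>i \<in> I\<close>, with values
  in \<open>L\<close>. (\<open>indep_var\<close> would force both families to have the same value type.)\<close>

definition gen_sigma :: "'a measure \<Rightarrow> 'i set \<Rightarrow> 'b measure \<Rightarrow> ('i \<Rightarrow> 'a \<Rightarrow> 'b) \<Rightarrow> 'a set set" where
  "gen_sigma M I L X = sigma_sets (space M) (\<Union>i\<in>I. {X i -` A \<inter> space M | A. A \<in> sets L})"

text \<open>A process on \<open>[0, \<infinity>)\<close> is a function on all reals; its values at negative times are irrelevant.
  The truncated subtraction below is harmless because the paths are almost surely nondecreasing.\<close>

definition poisson_process :: "'a measure \<Rightarrow> real \<Rightarrow> (real \<Rightarrow> 'a \<Rightarrow> nat) \<Rightarrow> bool" where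
  "poisson_process M r N \<longleftrightarrow>
     (\<forall>t\<ge>0. N t \<in> measurable M (count_space UNIV)) \<and>
     (AE \<omega> in M. N 0 \<omega> = 0 \<and> mono_on {0..} (\<lambda>t. N t \<omega>) \<and>
        (\<forall>s\<ge>0. continuous (at_right s) (\<lambda>t. N t \<omega>))) \<and>
     (\<forall>(n::nat) t. 0 \<le> t 0 \<longrightarrow> (\<forall>i<n. t i \<le> t (Suc i)) \<longrightarrow>
        prob_space.indep_vars M (\<lambda>_. count_space UNIV) (\<lambda>i \<omega>. N (t (Suc i)) \<omega> - N (t i) \<omega>) {..<n}) \<and>
     (\<forall>s t. 0 \<le> s \<longrightarrow> s < t \<longrightarrow>
        distr M (count_space UNIV) (\<lambda>\<omega>. N t \<omega> - N s \<omega>) = measure_pmf (poisson_pmf (r * (t - s))))"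

definition PPoK :: "'a measure \<Rightarrow> nat \<Rightarrow> real \<Rightarrow> (real \<Rightarrow> 'a \<Rightarrow> nat) \<Rightarrow> bool" where
  "PPoK M k lam Nk \<longleftrightarrow>
     (\<exists>(N :: real \<Rightarrow> 'a \<Rightarrow> nat) (X :: nat \<Rightarrow> 'a \<Rightarrow> nat).
        poisson_process M (real k * lam) N \<and>
        prob_space.indep_vars M (\<lambda>_. count_space UNIV) X {1..} \<and>
        (\<forall>i\<ge>1. distr M (count_space UNIV) (X i) = measure_pmf (pmf_of_set {1..k})) \<and>
        prob_space.indep_set M (gen_sigma M {0..} (count_space UNIV) N)
                               (gen_sigma M {1..} (count_space UNIV) X) \<and>
        (\<forall>t\<ge>0. \<forall>\<omega>\<in>space M. Nk t \<omega> = (\<Sum>i=1..N t \<omega>. X i \<omega>)))"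

definition CPPoK :: "'a measure \<Rightarrow> nat \<Rightarrow> real \<Rightarrow> (real \<Rightarrow> real) \<Rightarrow>
    (real \<Rightarrow> 'a \<Rightarrow> nat) \<Rightarrow> (nat \<Rightarrow> 'a \<Rightarrow> real) \<Rightarrow> (real \<Rightarrow> 'a \<Rightarrow> real) \<Rightarrow> bool" where
  "CPPoK M k lam H Nk Y Z \<longleftrightarrow>
     PPoK M k lam Nk \<and>
     prob_space.indep_vars M (\<lambda>_. borel) Y {1..} \<and>
     (\<forall>i\<ge>1. cdf (distr M borel (Y i)) = H) \<and>
     prob_space.indep_set M (gen_sigma M {0..} (count_space UNIV) Nk) (gen_sigma M {1..} borel Y) \<and>
     (\<forall>t\<ge>0. \<forall>\<omega>\<in>space M. Z t \<omega> = (\<Sum>i=1..Nk t \<omega>. Y i \<omega>))"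

text \<open>The reference measure \<open>\<nu>\<close> is \<^const>\<open>lborel\<close> when \<open>h\<close> is a density and \<open>count_space UNIV\<close> when \<open>h\<close>
  is a probability mass function (integrals against the latter are sums). Total mass one is not
  required separately: it follows when \<open>H\<close> is a distribution function.\<close>

definition has_density_wrt :: "real measure \<Rightarrow> (real \<Rightarrow> real) \<Rightarrow> (real \<Rightarrow> real) \<Rightarrow> bool" where
  "has_density_wrt \<nu> H h \<longleftrightarrow>
     h \<in> borel_measurable \<nu> \<and> (\<forall>x. 0 \<le> h x) \<and>
     (\<forall>x. set_integrable \<nu> {..x} h \<and> H x = (LINT u:{..x}|\<nu>. h u))"

text \<open>\<open>conv_Suc \<nu> h j\<close> is the convolution power \<open>h\<^sup>*\<^sup>(\<^sup>j\<^sup>+\<^sup>1\<^sup>)\<close> as a function.\<close>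

primrec conv_Suc :: "real measure \<Rightarrow> (real \<Rightarrow> real) \<Rightarrow> nat \<Rightarrow> real \<Rightarrow> ennreal" where
  "conv_Suc \<nu> h 0 = (\<lambda>x. ennreal (h x))"
| "conv_Suc \<nu> h (Suc j) = (\<lambda>x. \<integral>\<^sup>+u. conv_Suc \<nu> h j (x - u) * ennreal (h u) \<partial>\<nu>)"

text \<open>The measure written \<open>h\<^sup>*\<^sup>j(x) dx\<close>; for \<open>j = 0\<close> it is the Dirac mass at \<open>0\<close>.\<close>

primrec conv_measure :: "real measure \<Rightarrow> (real \<Rightarrow> real) \<Rightarrow> nat \<Rightarrow> real measure" where
  "conv_measure \<nu> h 0 = return \<nu> 0"
| "conv_measure \<nu> h (Suc j) = density \<nu> (conv_Suc \<nu> h j)"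

text \<open>\<open>iterated_integral L v r m x\<close> is the iterated integral of \<open>1\<close> over the \<open>r\<close> variables
  \<open>x\<^sub>m, \<dots>, x\<^sub>m\<^sub>+\<^sub>r\<^sub>-\<^sub>1\<close> (outermost first), where \<open>x\<^sub>i\<close> is integrated against \<open>L i\<close> over
  \<open>(-\<infinity>, v i x]\<close> and the limit \<open>v i x\<close> may depend on the variables already chosen.\<close>

primrec iterated_integral ::
    "(nat \<Rightarrow> real measure) \<Rightarrow> (nat \<Rightarrow> (nat \<Rightarrow> real) \<Rightarrow> real) \<Rightarrow> nat \<Rightarrow> nat \<Rightarrow> (nat \<Rightarrow> real) \<Rightarrow> real" where
  "iterated_integral L v 0 = (\<lambda>m x. 1)"
| "iterated_integral L v (Suc r) =
     (\<lambda>m x. LINT u:{..v m x}|L m. iterated_integral L v r (Suc m) (x(m := u)))"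

end

(*
The increments of Z over the intervals between consecutive times are sums of the Y's over consecutive
blocks of indices whose lengths are the increments of Nk. On the event that these increments equal
j 1, ..., j n, the blocks are deterministic, so the block sums are independent, have the laws h^{*j l},
and are independent of the event; their joint probability is the iterated integral. Summing over j it
remains to see that Nk has independent stationary increments. This is the same block argument applied
to the Poisson process N and the sequence X.
*)

theory Submission
  imports Defs
begin

section \<open>Increments and block sums\<close>

text \<open>An increment event is recorded by the values \<open>N (t l) = i 1 + ... + i l\<close>,
  not by differences. It then fixes all blocks of indices at each of its points, so the comparison
  with block sums is pointwise; the path properties, known only almost surely, enter when these
  events have to cover the space or be matched with truncated differences. Sums over multi-indices
  are carried as \<open>ennreal\<close> integrals against counting measure, where a sum of product
  weights factors without convergence questions; the lemma below returns to \<open>has_sum\<close>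
  at the end. This factorization gives the increments of \<open>Nk\<close> without computing the law
  of a sum of uniform variables. A density and a mass function live on different sigma-algebras, the
  Borel sets and all subsets. Pushing forward along the identity to \<open>borel\<close> lets one
  argument treat both.\<close>

lemma has_sum_nn_integral_count_space:
  fixes f :: "'a \<Rightarrow> real"
  assumes "(\<integral>\<^sup>+x. ennreal (f x) \<partial>count_space A) = ennreal c"
    and nonneg: "\<And>x. x \<in> A \<Longrightarrow> 0 \<le> f x" and "0 \<le> c"
  shows "(f has_sum c) A"
proof -
  have abs: "Infinite_Set_Sum.abs_summable_on f A"
    unfolding abs_summable_on_def using assms by (intro integrableI_nonneg) (auto simp: AE_count_space)
  have "infsetsum f A = c"
    using assms by (subst infsetsum_conv_nn_integral) auto
  moreover have "f summable_on A"
    using abs abs_summable_equivalent abs_summable_summable by blast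
  ultimately show ?thesis
    using infsetsum_infsum[OF abs] has_sum_infsum by metis
qed

text \<open>Consecutive partial sums differ by one term. This translates between cumulative values
  and increments without subtraction on \<open>nat\<close>.\<close>

lemma partial_sums_eq_iff:
  fixes a b :: "nat \<Rightarrow> nat"
  shows "(\<forall>l\<in>{1..n}. (\<Sum>m=1..l. a m) = (\<Sum>m=1..l. b m)) \<longleftrightarrow> (\<forall>l\<in>{1..n}. a l = b l)"
proof
  assume eq: "\<forall>l\<in>{1..n}. (\<Sum>m=1..l. a m) = (\<Sum>m=1..l. b m)"
  show "\<forall>l\<in>{1..n}. a l = b l"
  proof
    fix l assume l: "l \<in> {1..n}"
    then obtain l' where l': "l = Suc l'" by (cases l) auto
    have "(\<Sum>m=1..l'. a m) = (\<Sum>m=1..l'. b m)"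
      using bspec[OF eq, of l'] l l' by (cases "l' = 0") auto
    with bspec[OF eq l] l' show "a l = b l" by simp
  qed
qed (auto intro!: sum.cong)

text \<open>\<open>K l\<close> is a counting path at the l-th time. Almost surely it consists of the
  partial sums of its increments, so the events cover the space up to a null set; partial sums
  determine increments, so the events are disjoint. The index set is countable.\<close>

lemma (in prob_space) emeasure_split_increments:
  fixes K :: "nat \<Rightarrow> 'a \<Rightarrow> nat"
  assumes K [measurable]: "\<And>l. l \<in> {1..n} \<Longrightarrow> K l \<in> measurable M (count_space UNIV)"
    and mono: "AE \<omega> in M. K 0 \<omega> = 0 \<and> (\<forall>l\<in>{1..n}. K (l - 1) \<omega> \<le> K l \<omega>)"
    and Q [measurable]: "Q \<in> sets M"
  shows "emeasure M Q = (\<integral>\<^sup>+i. emeasure M (Q \<inter> {\<omega>\<in>space M. \<forall>l\<in>{1..n}. K l \<omega> = (\<Sum>m=1..l. i m)})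
           \<partial>count_space ({1..n} \<rightarrow>\<^sub>E UNIV))"
    (is "_ = (\<integral>\<^sup>+i. emeasure M (Q \<inter> ?E i) \<partial>count_space ?I)")
proof -
  have E [measurable]: "?E i \<in> sets M" for i
    by measurable
  have cI: "countable ?I"
    by (rule countable_PiE) auto
  have "emeasure M Q = emeasure M (\<Union>i\<in>?I. Q \<inter> ?E i)"
  proof (rule emeasure_eq_AE)
    show "AE \<omega> in M. \<omega> \<in> Q \<longleftrightarrow> \<omega> \<in> (\<Union>i\<in>?I. Q \<inter> ?E i)"
      using mono AE_space
    proof eventually_elim
      case (elim \<omega>)
      \<comment> \<open>Truncated subtraction is exact here, since the path is monotone at this
        \<open>\<omega>\<close>.\<close>
      define i where "i = (\<lambda>l\<in>{1..n}. K l \<omega> - K (l - 1) \<omega>)"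
      have "l \<le> n \<Longrightarrow> (\<Sum>m=1..l. i m) = K l \<omega>" for l
      proof (induction l)
        case (Suc l)
        then have "K l \<omega> \<le> K (Suc l) \<omega>" using elim(1) by (auto dest: bspec[of _ _ "Suc l"])
        with Suc show ?case by (simp add: i_def)
      qed (use elim in simp)
      moreover have "i \<in> ?I" by (simp add: i_def)
      ultimately show ?case using elim(2) by (auto intro!: bexI[of _ i])
    qed
    next
    show "(\<Union>i\<in>?I. Q \<inter> ?E i) \<in> sets M"
      by (rule sets.countable_UN'[OF cI]) auto
  qed fact
  also have "\<dots> = (\<integral>\<^sup>+i. emeasure M (Q \<inter> ?E i) \<partial>count_space ?I)"
  proof (rule emeasure_UN_countable[OF _ cI])
    show "disjoint_family_on (\<lambda>i. Q \<inter> ?E i) ?I"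
      unfolding disjoint_family_on_def
    proof (intro ballI impI)
      fix i j assume ij: "i \<in> ?I" "j \<in> ?I" "i \<noteq> j"
      have False if "\<omega> \<in> ?E i" "\<omega> \<in> ?E j" for \<omega>
      proof -
        have "\<forall>l\<in>{1..n}. (\<Sum>m=1..l. i m) = (\<Sum>m=1..l. j m)"
          using that by simp
        then have "\<forall>l\<in>{1..n}. i l = j l"
          by (simp only: partial_sums_eq_iff)
        \<comment> \<open>Index functions are extensional, so agreement on \<open>{1..n}\<close>
          makes them equal.\<close>
        with PiE_ext[OF ij(1,2)] ij(3) show False by blast
      qed
      then show "(Q \<inter> ?E i) \<inter> (Q \<inter> ?E j) = {}" by blast
    qed
  qed auto
  finally show ?thesis .
qed

text \<open>The last summand is independent of the earlier ones. Its law is put on the right to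
  match the recursion of \<open>conv_Suc\<close>. The offset \<open>a\<close> is free so that blocks
  at different positions can be compared; \<open>a = 0\<close> gives the convolution powers.\<close>

lemma (in prob_space) distr_sum_block_Suc:
  fixes X :: "nat \<Rightarrow> 'a \<Rightarrow> real"
  assumes ind: "indep_vars (\<lambda>_. borel) X {1..}"
    and law: "\<And>i. i \<ge> 1 \<Longrightarrow> distr M borel (X i) = \<mu>"
  shows "distr M borel (\<lambda>\<omega>. \<Sum>i\<in>{a<..a + Suc j}. X i \<omega>) =
         convolution (distr M borel (\<lambda>\<omega>. \<Sum>i\<in>{a<..a + j}. X i \<omega>)) \<mu>"
proof -
  have rv [measurable]: "i \<ge> 1 \<Longrightarrow> random_variable borel (X i)" for i
    using ind by (auto simp: indep_vars_def)
  have ins: "{a<..a + Suc j} = insert (a + Suc j) {a<..a + j}" by auto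
  have "indep_var borel (X (a + Suc j)) borel (\<lambda>\<omega>. \<Sum>i\<in>{a<..a + j}. X i \<omega>)"
    by (rule indep_vars_sum) (auto intro!: indep_vars_subset[OF ind])
  then have "distr M borel (\<lambda>\<omega>. X (a + Suc j) \<omega> + (\<Sum>i\<in>{a<..a + j}. X i \<omega>)) =
      convolution (distr M borel (X (a + Suc j))) (distr M borel (\<lambda>\<omega>. \<Sum>i\<in>{a<..a + j}. X i \<omega>))"
    by (rule sum_indep_random_variable) measurable
  also have "\<dots> = convolution (distr M borel (\<lambda>\<omega>. \<Sum>i\<in>{a<..a + j}. X i \<omega>)) (distr M borel (X (a + Suc j)))"
    by (rule convolution_commutative) (auto intro!: finite_measure_distr)
  finally show ?thesis
    unfolding ins by (simp add: law)
qed

text \<open>Both laws obey the same convolution recursion in \<open>j\<close> and start from the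
  empty sum.\<close>

lemma (in prob_space) distr_sum_block_shift:
  fixes X :: "nat \<Rightarrow> 'a \<Rightarrow> real"
  assumes ind: "indep_vars (\<lambda>_. borel) X {1..}"
    and law: "\<And>i. i \<ge> 1 \<Longrightarrow> distr M borel (X i) = \<mu>"
  shows "distr M borel (\<lambda>\<omega>. \<Sum>i\<in>{a<..a + j}. X i \<omega>) = distr M borel (\<lambda>\<omega>. \<Sum>i=1..j. X i \<omega>)"
proof -
  have "distr M borel (\<lambda>\<omega>. \<Sum>i\<in>{a<..a + j}. X i \<omega>) = distr M borel (\<lambda>\<omega>. \<Sum>i\<in>{0<..0 + j}. X i \<omega>)"
  proof (induction j)
    case (Suc j)
    then show ?case
      using distr_sum_block_Suc[OF ind law, of a j] distr_sum_block_Suc[OF ind law, of 0 j] by metis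
  qed simp
  moreover have "{0<..0 + j} = {1..j}" by auto
  ultimately show ?thesis by simp
qed

text \<open>\<open>gen_sigma\<close> is a bare family of sets. Hypothesis \<open>f\<close> speaks of
  an arbitrary space \<open>S\<close> carrying that family, so ordinary measurability rules for
  functions of the \<open>X i\<close> can place an event in it.\<close>

lemma measurable_vimage_gen_sigma:
  assumes "\<And>i. i \<in> I \<Longrightarrow> X i \<in> space M \<rightarrow> space L"
    and f: "\<And>S. sets S = gen_sigma M I L X \<Longrightarrow> space S = space M \<Longrightarrow>
          (\<And>i. i \<in> I \<Longrightarrow> X i \<in> measurable S L) \<Longrightarrow> f \<in> measurable S L'"
    and A: "A \<in> sets L'"
  shows "f -` A \<inter> space M \<in> gen_sigma M I L X"
proof -
  let ?G = "\<Union>i\<in>I. {X i -` A \<inter> space M | A. A \<in> sets L}"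
  define S where "S = sigma (space M) ?G"
  have G: "?G \<subseteq> Pow (space M)" by auto
  have S: "sets S = gen_sigma M I L X" "space S = space M"
    using G by (simp_all add: S_def gen_sigma_def)
  have "X i \<in> measurable S L" if i: "i \<in> I" for i
  proof (rule measurableI)
    fix \<omega> assume "\<omega> \<in> space S"
    then show "X i \<omega> \<in> space L" using assms(1)[OF i] S by auto
  next
    fix B assume "B \<in> sets L"
    then have "X i -` B \<inter> space M \<in> ?G" using i by blast
    then show "X i -` B \<inter> space S \<in> sets S"
      unfolding S gen_sigma_def by (rule sigma_sets.Basic)
  qed
  from f[OF S this] A have "f -` A \<inter> space S \<in> sets S"
    by (rule measurable_sets)
  then show ?thesis by (simp add: S)
qed

lemma gen_sigma_mono:
  assumes "\<And>i A. i \<in> I \<Longrightarrow> A \<in> sets L' \<Longrightarrow> \<exists>B\<in>sets L. X' i -` A \<inter> space M = X i -` B \<inter> space M"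
  shows "gen_sigma M I L' X' \<subseteq> gen_sigma M I L X"
  unfolding gen_sigma_def
proof (rule sigma_sets_mono', rule subsetI)
  fix B assume "B \<in> (\<Union>i\<in>I. {X' i -` A \<inter> space M | A. A \<in> sets L'})"
  then obtain i A where i: "i \<in> I" and "A \<in> sets L'" "B = X' i -` A \<inter> space M" by blast
  with assms[of i A] obtain C where "C \<in> sets L" "B = X i -` C \<inter> space M" by metis
  with i show "B \<in> (\<Union>i\<in>I. {X i -` A \<inter> space M | A. A \<in> sets L})" by blast
qed

lemma partial_sums_mono:
  fixes i :: "nat \<Rightarrow> nat"
  shows "l \<le> l' \<Longrightarrow> (\<Sum>m=1..l. i m) \<le> (\<Sum>m=1..l'. i m)"
  by (rule sum_mono2) auto

text \<open>For fixed \<open>i\<close> the blocks are disjoint deterministic index sets, so the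
  block sums are independent with laws depending only on the lengths \<open>i l\<close>. An event
  about them lies in the sigma-algebra of \<open>X\<close> and splits off from \<open>E\<close>.
  \<open>F\<close> stays abstract: it is generated by the Poisson process in one application and by
  the process of order k in the other.\<close>

lemma (in prob_space) emeasure_indep_block_sums:
  fixes X :: "nat \<Rightarrow> 'a \<Rightarrow> real" and i :: "nat \<Rightarrow> nat"
  assumes ind: "indep_vars (\<lambda>_. borel) X {1..}"
    and law: "\<And>i. i \<ge> 1 \<Longrightarrow> distr M borel (X i) = \<mu>"
    and F: "indep_set F (gen_sigma M {1..} borel X)" "E \<in> F"
    and A: "A \<in> sets (PiM {1..n} (\<lambda>_. borel))" and "n \<ge> 1"
  shows "emeasure M (E \<inter> {\<omega>\<in>space M. (\<lambda>l\<in>{1..n}. \<Sum>r\<in>{(\<Sum>m=1..l - 1. i m)<..(\<Sum>m=1..l. i m)}. X r \<omega>) \<in> A}) =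
     emeasure M E * emeasure (PiM {1..n} (\<lambda>l. distr M borel (\<lambda>\<omega>. \<Sum>r=1..i l. X r \<omega>))) A"
proof -
  let ?b = "\<lambda>l. \<Sum>m=1..l. i m"
  let ?K = "\<lambda>l. {?b (l - 1)<..?b l}"
  let ?W = "\<lambda>l \<omega>. \<Sum>r\<in>?K l. X r \<omega>"
  have rv [measurable]: "i \<ge> 1 \<Longrightarrow> random_variable borel (X i)" for i
    using ind by (auto simp: indep_vars_def)
  have disj: "disjoint_family_on ?K {1..n}"
    unfolding disjoint_family_on_def
  proof (intro ballI impI)
    fix l l' :: nat assume "l \<in> {1..n}" "l' \<in> {1..n}" "l \<noteq> l'"
    \<comment> \<open>Block boundaries are nondecreasing, so one block ends no later than the
      excluded left endpoint of the other.\<close>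
    then have "l \<le> l' - 1 \<or> l' \<le> l - 1" by auto
    then have "?b l \<le> ?b (l' - 1) \<or> ?b l' \<le> ?b (l - 1)"
      using partial_sums_mono by blast
    then show "?K l \<inter> ?K l' = {}" by auto
  qed
  have "indep_vars (\<lambda>l. PiM (?K l) (\<lambda>_. borel)) (\<lambda>l \<omega>. restrict (\<lambda>r. X r \<omega>) (?K l)) {1..n}"
    by (rule indep_vars_restrict[OF ind _ disj]) auto
  then have "indep_vars (\<lambda>_. borel) (\<lambda>l \<omega>. \<Sum>r\<in>?K l. (restrict (\<lambda>r. X r \<omega>) (?K l)) r) {1..n}"
    by (rule indep_vars_compose2[where Y = "\<lambda>l f. \<Sum>r\<in>?K l. f r"]) measurable
  then have W: "indep_vars (\<lambda>_. borel) ?W {1..n}"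
    by simp
  have rvW: "random_variable borel (?W l)" for l
    by (intro borel_measurable_sum rv) auto
  have joint: "distr M (PiM {1..n} (\<lambda>_. borel)) (\<lambda>\<omega>. \<lambda>l\<in>{1..n}. ?W l \<omega>) = PiM {1..n} (\<lambda>l. distr M borel (?W l))"
    using W rvW \<open>n \<ge> 1\<close> by (subst (asm) indep_vars_iff_distr_eq_PiM) auto
  have lawW: "distr M borel (?W l) = distr M borel (\<lambda>\<omega>. \<Sum>r=1..i l. X r \<omega>)" if "l \<in> {1..n}" for l
  proof -
    from that obtain l' where "l = Suc l'" by (cases l) auto
    then have "?b l = ?b (l - 1) + i l" by simp
    then show ?thesis
      using distr_sum_block_shift[OF ind law, of "?b (l - 1)" "i l"] by simp
  qed
  let ?D = "{\<omega>\<in>space M. (\<lambda>l\<in>{1..n}. ?W l \<omega>) \<in> A}"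
  have D_eq: "?D = (\<lambda>\<omega>. \<lambda>l\<in>{1..n}. ?W l \<omega>) -` A \<inter> space M" by auto
  have D: "?D \<in> gen_sigma M {1..} borel X"
    unfolding D_eq
  proof (rule measurable_vimage_gen_sigma[OF _ _ A])
    fix S :: "'a measure" assume "\<And>i. i \<in> {1..} \<Longrightarrow> X i \<in> borel_measurable S"
    then show "(\<lambda>\<omega>. \<lambda>l\<in>{1..n}. ?W l \<omega>) \<in> measurable S (PiM {1..n} (\<lambda>_. borel))"
      by (intro measurable_restrict borel_measurable_sum) auto
  qed auto
  have "emeasure M (E \<inter> ?D) = emeasure M E * emeasure M ?D"
    using indep_setD[OF F D] by (simp add: emeasure_eq_measure ennreal_mult'')
  also have "emeasure M ?D = emeasure (distr M (PiM {1..n} (\<lambda>_. borel)) (\<lambda>\<omega>. \<lambda>l\<in>{1..n}. ?W l \<omega>)) A"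
    unfolding D_eq using A rvW by (subst emeasure_distr) (auto intro!: measurable_restrict)
  also have "distr M (PiM {1..n} (\<lambda>_. borel)) (\<lambda>\<omega>. \<lambda>l\<in>{1..n}. ?W l \<omega>) =
      PiM {1..n} (\<lambda>l. distr M borel (\<lambda>\<omega>. \<Sum>r=1..i l. X r \<omega>))"
    unfolding joint by (rule PiM_cong) (use lawW in auto)
  finally show ?thesis .
qed

section \<open>Convolution powers and iterated integrals\<close>

text \<open>The pushed-forward measure agrees with \<open>\<mu>\<close> on half-lines, and a
  probability measure on the line is determined by its distribution function.\<close>

lemma has_density_wrt_distr:
  assumes \<nu>: "\<nu> = lborel \<or> \<nu> = count_space UNIV"
    and h: "has_density_wrt \<nu> (cdf \<mu>) h" and \<mu>: "real_distribution \<mu>"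
  shows "distr (density \<nu> (\<lambda>x. ennreal (h x))) borel (\<lambda>x. x) = \<mu>"
proof -
  interpret real_distribution \<mu> by fact
  let ?\<mu>' = "distr (density \<nu> (\<lambda>x. ennreal (h x))) borel (\<lambda>x. x)"
  have [measurable]: "h \<in> borel_measurable \<nu>" and h0: "\<And>x. 0 \<le> h x"
    and int: "\<And>x. set_integrable \<nu> {..x} h" and cdf: "\<And>x. cdf \<mu> x = (LINT u:{..x}|\<nu>. h u)"
    using h by (auto simp: has_density_wrt_def)
  have id: "(\<lambda>x. x) \<in> measurable \<nu> borel" and [measurable]: "{..x} \<in> sets \<nu>" for x :: real
    using \<nu> by auto
  have atMost: "emeasure ?\<mu>' {..x} = ennreal (cdf \<mu> x)" for x
  proof -
    have "emeasure ?\<mu>' {..x} = (\<integral>\<^sup>+u. ennreal (h u) * indicator {..x} u \<partial>\<nu>)"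
      using \<nu> id by (subst emeasure_distr) (auto simp: emeasure_density)
    also have "\<dots> = (\<integral>\<^sup>+u. ennreal (indicator {..x} u *\<^sub>R h u) \<partial>\<nu>)"
      by (intro nn_integral_cong) (simp split: split_indicator)
    also have "\<dots> = ennreal (cdf \<mu> x)"
      using int[of x] h0 unfolding cdf set_lebesgue_integral_def set_integrable_def
      by (subst nn_integral_eq_integral) auto
    finally show ?thesis .
  qed
  \<comment> \<open>The total mass of \<open>h\<close> is the limit of the distribution function at
    infinity, hence 1.\<close>
  have "(\<lambda>i. emeasure ?\<mu>' {..real i}) \<longlonglongrightarrow> emeasure ?\<mu>' (\<Union>i. {..real i})"
    by (rule Lim_emeasure_incseq) (auto simp: incseq_def)
  moreover have "(\<Union>i. {..real i}) = UNIV"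
    using real_arch_simple by auto
  moreover have "(\<lambda>i. emeasure ?\<mu>' {..real i}) \<longlonglongrightarrow> ennreal 1"
    unfolding atMost
    by (intro tendsto_ennrealI filterlim_compose[OF cdf_lim_at_top_prob] filterlim_real_sequentially)
  ultimately have "emeasure ?\<mu>' UNIV = 1"
    using LIMSEQ_unique by fastforce
  then have prob: "prob_space ?\<mu>'"
    by (intro prob_spaceI) simp
  show ?thesis
  proof (rule cdf_unique)
    show "real_distribution ?\<mu>'"
      using prob by (simp add: real_distribution_def real_distribution_axioms_def)
    show "cdf ?\<mu>' = cdf \<mu>"
      using atMost by (auto simp: cdf_def2 measure_def fun_eq_iff)
  qed fact
qed

lemma borel_measurable_conv_Suc:
  assumes "h \<in> borel_measurable borel"
  shows "conv_Suc lborel h j \<in> borel_measurable borel"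
proof (induction j)
  case (Suc j)
  note Suc[measurable] assms[measurable]
  show ?case by simp
qed (use assms in simp)

lemma nn_integral_count_space_swap:
  "(\<integral>\<^sup>+x. \<integral>\<^sup>+y. f x y \<partial>count_space UNIV \<partial>count_space UNIV) =
   (\<integral>\<^sup>+y. \<integral>\<^sup>+x. f x y \<partial>count_space UNIV \<partial>count_space UNIV)"
  using nn_integral_fst_count_space[of "\<lambda>(x, y). f x y"] nn_integral_snd_count_space[of "\<lambda>(x, y). f x y"]
  by simp

text \<open>The measures on \<open>count_space UNIV\<close> are not \<open>\<sigma>\<close>-finite on the uncountable type \<^typ>\<open>real\<close>,
  so Fubini's theorem is replaced by the interchange of sums.\<close>

lemma convolution_density_count_space:
  fixes f g :: "real \<Rightarrow> ennreal"
  defines "D \<equiv> \<lambda>f. distr (density (count_space UNIV) f) borel (\<lambda>x. x)"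
  assumes fin: "finite_measure (D f)" "finite_measure (D g)"
  shows "convolution (D f) (D g) = D (\<lambda>x. \<integral>\<^sup>+y. f (x - y) * g y \<partial>count_space UNIV)"
proof (rule measure_eqI)
  show "sets (convolution (D f) (D g)) = sets (D (\<lambda>x. \<integral>\<^sup>+y. f (x - y) * g y \<partial>count_space UNIV))"
    by (simp add: D_def)
  fix A assume "A \<in> sets (convolution (D f) (D g))"
  then have A [measurable]: "A \<in> sets borel" by simp
  have D: "(\<integral>\<^sup>+x. k x \<partial>D f) = (\<integral>\<^sup>+x. f x * k x \<partial>count_space UNIV)"
    if "k \<in> borel_measurable borel" for f k
    using that unfolding D_def by (subst nn_integral_distr) (auto simp: nn_integral_density)
  interpret g: finite_measure "D g" by (rule fin)
  have [measurable_cong]: "sets (D g) = sets borel" by (simp add: D_def)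
  let ?I = "\<lambda>z. indicator A z :: ennreal"
  have "emeasure (convolution (D f) (D g)) A = (\<integral>\<^sup>+x. \<integral>\<^sup>+y. ?I (x + y) \<partial>D g \<partial>D f)"
    using nn_integral_convolution[OF fin, of ?I] A by (simp add: D_def)
  also have "\<dots> = (\<integral>\<^sup>+x. f x * (\<integral>\<^sup>+y. ?I (x + y) \<partial>D g) \<partial>count_space UNIV)"
    by (rule D) measurable
  also have "\<dots> = (\<integral>\<^sup>+x. \<integral>\<^sup>+y. f x * (g y * ?I (x + y)) \<partial>count_space UNIV \<partial>count_space UNIV)"
    by (simp add: D nn_integral_cmult)
  also have "\<dots> = (\<integral>\<^sup>+y. \<integral>\<^sup>+x. f x * (g y * ?I (x + y)) \<partial>count_space UNIV \<partial>count_space UNIV)"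
    by (rule nn_integral_count_space_swap)
  \<comment> \<open>Substitute \<open>x = z - y\<close>: counting measure is invariant under
    bijections.\<close>
  also have "\<dots> = (\<integral>\<^sup>+y. \<integral>\<^sup>+z. f (z - y) * g y * ?I z \<partial>count_space UNIV \<partial>count_space UNIV)"
  proof (rule nn_integral_cong)
    fix y
    have "bij_betw (\<lambda>z::real. z - y) UNIV UNIV"
      by (rule bij_betwI[where g = "\<lambda>x::real. x + y"]) auto
    from nn_integral_bij_count_space[OF this, of "\<lambda>x. f x * (g y * ?I (x + y))"]
    show "(\<integral>\<^sup>+x. f x * (g y * ?I (x + y)) \<partial>count_space UNIV) =
        (\<integral>\<^sup>+z. f (z - y) * g y * ?I z \<partial>count_space UNIV)"
      by (simp add: mult.assoc)
  qed
  also have "\<dots> = (\<integral>\<^sup>+z. \<integral>\<^sup>+y. f (z - y) * g y * ?I z \<partial>count_space UNIV \<partial>count_space UNIV)"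
    by (rule nn_integral_count_space_swap)
  also have "\<dots> = (\<integral>\<^sup>+z. (\<integral>\<^sup>+y. f (z - y) * g y \<partial>count_space UNIV) * ?I z \<partial>count_space UNIV)"
    by (simp add: nn_integral_multc)
  also have "\<dots> = emeasure (D (\<lambda>x. \<integral>\<^sup>+y. f (x - y) * g y \<partial>count_space UNIV)) A"
    unfolding D_def by (subst emeasure_distr) (auto simp: emeasure_density)
  finally show "emeasure (convolution (D f) (D g)) A =
      emeasure (D (\<lambda>x. \<integral>\<^sup>+y. f (x - y) * g y \<partial>count_space UNIV)) A" .
qed

text \<open>The recursion starts at the first power because the Dirac mass is not a Lebesgue
  density, so power 0 lies outside \<open>conv_Suc\<close>. For \<open>lborel\<close> the
  push-forward along the identity changes nothing.\<close>

lemma distr_conv_measure_Suc: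
  assumes \<nu>: "\<nu> = lborel \<or> \<nu> = count_space UNIV" and h: "h \<in> borel_measurable \<nu>"
    and fin: "finite_measure (distr (conv_measure \<nu> h (Suc j)) borel (\<lambda>x. x))"
      "finite_measure (distr (density \<nu> (\<lambda>x. ennreal (h x))) borel (\<lambda>x. x))"
  shows "distr (conv_measure \<nu> h (Suc (Suc j))) borel (\<lambda>x. x) =
     convolution (distr (conv_measure \<nu> h (Suc j)) borel (\<lambda>x. x))
       (distr (density \<nu> (\<lambda>x. ennreal (h x))) borel (\<lambda>x. x))"
  using \<nu>
proof
  assume [simp]: "\<nu> = count_space UNIV"
  show ?thesis
    using convolution_density_count_space[of "conv_Suc \<nu> h j" "\<lambda>x. ennreal (h x)"] fin by simp
next
  assume \<nu>: "\<nu> = lborel"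
  have id: "distr (density lborel f) borel (\<lambda>x. x) = density lborel f" for f
    by (rule distr_id2) simp
  show ?thesis
    using convolution_density[of "conv_Suc \<nu> h j" "\<lambda>x. ennreal (h x)"] fin h
      borel_measurable_conv_Suc[of h j]
    by (simp add: \<nu> id)
qed

lemma distr_conv_measure_0:
  assumes \<nu>: "\<nu> = lborel \<or> \<nu> = count_space UNIV"
  shows "distr (conv_measure \<nu> h 0) borel (\<lambda>x. x) = return borel 0"
  using \<nu> by (auto intro!: distr_return)

section \<open>Iterated integrals as probabilities under a product measure\<close>

lemma prod_indicator_eq_all:
  "finite I \<Longrightarrow> (\<Prod>l\<in>I. indicator (S l) (f l)) =
    (if \<forall>l\<in>I. f l \<in> S l then 1 else (0 :: ennreal))"
  by (induction I rule: finite_induct) (auto simp: indicator_def)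

text \<open>The upper limit for the l-th variable says that the partial sum up to \<open>l\<close>
  is at most \<open>y l\<close>; integrating the first coordinate of the product measure last
  reproduces one level of the iterated integral. For the induction the start \<open>m\<close> is
  arbitrary and \<open>x\<close> holds the variables already chosen, seen through their sum.\<close>

lemma iterated_integral_eq_measure_PiM:
  fixes L :: "nat \<Rightarrow> real measure" and y :: "nat \<Rightarrow> real"
  assumes L: "\<And>m. prob_space (distr (L m) borel (\<lambda>x. x))"
    and id: "\<And>m. (\<lambda>x. x) \<in> measurable (L m) borel"
  shows "m \<ge> 1 \<Longrightarrow> iterated_integral L (\<lambda>m x. y m - (\<Sum>l=1..<m. x l)) r m x =
     measure (PiM {m..<m + r} (\<lambda>m. distr (L m) borel (\<lambda>x. x)))
       {w \<in> space (PiM {m..<m + r} (\<lambda>_. borel)).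
         \<forall>l\<in>{m..<m + r}. (\<Sum>i=1..<m. x i) + (\<Sum>i=m..l. w i) \<le> y l}"
proof (induction r arbitrary: m x)
  case 0
  show ?case by (simp add: PiM_empty measure_def)
next
  case (Suc r)
  let ?\<mu> = "\<lambda>m. distr (L m) borel (\<lambda>x. x)"
  let ?I = "{Suc m..<Suc m + r}"
  let ?P = "PiM ?I ?\<mu>"
  interpret product_prob_space ?\<mu> by (intro product_prob_spaceI L)
  interpret R: prob_space ?P by (intro prob_space_PiM L)
  interpret Q': prob_space "PiM (insert m ?I) ?\<mu>" by (intro prob_space_PiM L)
  define s where "s = (\<Sum>i=1..<m. x i)"
  define B where "B u = {w \<in> space (PiM ?I (\<lambda>_. borel)). \<forall>l\<in>?I. (s + u) + (\<Sum>i=Suc m..l. w i) \<le> y l}" for u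
  define A where "A = {w \<in> space (PiM (insert m ?I) (\<lambda>_. borel)). \<forall>l\<in>insert m ?I. s + (\<Sum>i=m..l. w i) \<le> y l}"
  have ins: "{m..<m + Suc r} = insert m ?I" by auto
  have space: "space (PiM J ?\<mu>) = space (PiM J (\<lambda>_. borel))" for J
    by (simp add: space_PiM)
  have sets [measurable_cong]: "sets (PiM J ?\<mu>) = sets (PiM J (\<lambda>_. borel))" for J
    by (rule sets_PiM_cong) auto
  have A_sets: "A \<in> sets (PiM (insert m ?I) ?\<mu>)"
  proof -
    \<comment> \<open>The intersection leaves each sum unchanged; it shows that every coordinate
      read belongs to the index set, as measurability requires.\<close>
    have "A = {w \<in> space (PiM (insert m ?I) (\<lambda>_. borel)). \<forall>l\<in>insert m ?I. s + (\<Sum>i\<in>{m..l} \<inter> insert m ?I. w i) \<le> y l}"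
      unfolding A_def by (intro Collect_cong conj_cong refl ball_cong arg_cong2[where f="(\<le>)"] arg_cong2[where f="(+)"] sum.cong) auto
    then show ?thesis unfolding sets by simp
  qed
  have B_sets: "B u \<in> sets ?P" for u
  proof -
    have "B u = {w \<in> space (PiM ?I (\<lambda>_. borel)). \<forall>l\<in>?I. (s + u) + (\<Sum>i\<in>{Suc m..l} \<inter> ?I. w i) \<le> y l}"
      unfolding B_def by (intro Collect_cong conj_cong refl ball_cong arg_cong2[where f="(\<le>)"] arg_cong2[where f="(+)"] sum.cong) auto
    then show ?thesis unfolding sets by simp
  qed
  have B_ind: "(indicator (B u) w :: ennreal) = (\<Prod>l\<in>?I. indicator {..y l} (s + u + (\<Sum>i\<in>{Suc m..l} \<inter> ?I. w i)))"
    (is "_ = (\<Prod>l\<in>?I. ?ind u w l)")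
    if "w \<in> space ?P" for u and w :: "nat \<Rightarrow> real"
  proof -
    have "(\<Sum>i\<in>{Suc m..l} \<inter> ?I. w i) = (\<Sum>i=Suc m..l. w i)" if "l \<in> ?I" for l
      using that by (intro sum.cong) auto
    then show ?thesis
      using that[unfolded space] by (subst prod_indicator_eq_all) (auto simp: B_def indicator_def)
  qed
  \<comment> \<open>The region depends on \<open>u\<close>. Its indicator is a finite product of
    half-line indicators at jointly measurable functions of \<open>u\<close> and \<open>w\<close>,
    so integrating out \<open>w\<close> leaves a measurable function of \<open>u\<close>.\<close>
  have meas_B: "(\<lambda>u. emeasure ?P (B u)) \<in> borel_measurable borel"
  proof -
    have "(\<lambda>u. \<integral>\<^sup>+w. (\<Prod>l\<in>?I. ?ind u w l) \<partial>?P) \<in> borel_measurable borel"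
      by measurable
    also have "(\<lambda>u. \<integral>\<^sup>+w. (\<Prod>l\<in>?I. ?ind u w l) \<partial>?P) = (\<lambda>u. emeasure ?P (B u))"
    proof
      fix u
      have "(\<integral>\<^sup>+w. (\<Prod>l\<in>?I. ?ind u w l) \<partial>?P) = (\<integral>\<^sup>+w. indicator (B u) w \<partial>?P)"
        by (intro nn_integral_cong) (simp only: B_ind)
      also have "\<dots> = emeasure ?P (B u)" using B_sets by simp
      finally show "(\<integral>\<^sup>+w. (\<Prod>l\<in>?I. ?ind u w l) \<partial>?P) = emeasure ?P (B u)" .
    qed
    finally show ?thesis .
  qed
  have IH: "iterated_integral L (\<lambda>m x. y m - (\<Sum>l=1..<m. x l)) r (Suc m) (x(m := u)) = measure ?P (B u)" for u
  proof -
    have "(\<Sum>i=1..<m. (x(m := u)) i) = s"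
      unfolding s_def by (intro sum.cong) auto
    \<comment> \<open>\<open>m \<ge> 1\<close> puts \<open>m\<close> into
      \<open>{1..<Suc m}\<close>, so the chosen \<open>u\<close> joins the prefix sum.\<close>
    then have s': "(\<Sum>i=1..<Suc m. (x(m := u)) i) = s + u"
      using Suc.prems by (simp add: atLeastLessThanSuc)
    show ?thesis
      using Suc.IH[of "Suc m" "x(m := u)", unfolded s', OF le_SucI[OF Suc.prems]] unfolding B_def .
  qed
  \<comment> \<open>The constraint at \<open>l = m\<close> is the half-line for \<open>u\<close>;
    the others constrain \<open>w\<close> with prefix \<open>s + u\<close>.\<close>
  have AB: "indicator A (w(m := u)) = (indicator {..y m - s} u * indicator (B u) w :: ennreal)"
    if "w \<in> space ?P" for u w
  proof -
    have "(\<Sum>i=m..l. (w(m := u)) i) = u + (\<Sum>i=Suc m..l. w i)" if "l \<ge> m" for l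
    proof -
      have "{m..l} = insert m {Suc m..l}" using that by auto
      moreover have "(\<Sum>i=Suc m..l. (w(m := u)) i) = (\<Sum>i=Suc m..l. w i)"
        by (intro sum.cong) auto
      ultimately show ?thesis by simp
    qed
    moreover have "w(m := u) \<in> space (PiM (insert m ?I) (\<lambda>_. borel))" "w \<in> space (PiM ?I (\<lambda>_. borel))"
      using that by (auto simp: space_PiM PiE_def extensional_def)
    ultimately show ?thesis
      by (auto simp: A_def B_def indicator_def add.assoc)
  qed
  have "emeasure (PiM (insert m ?I) ?\<mu>) A = (\<integral>\<^sup>+w. indicator A w \<partial>PiM (insert m ?I) ?\<mu>)"
    using A_sets by simp
  also have "\<dots> = (\<integral>\<^sup>+u. (\<integral>\<^sup>+w. indicator A (w(m := u)) \<partial>?P) \<partial>?\<mu> m)"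
    using A_sets by (intro product_nn_integral_insert_rev) auto
  also have "\<dots> = (\<integral>\<^sup>+u. (\<integral>\<^sup>+w. indicator {..y m - s} u * indicator (B u) w \<partial>?P) \<partial>?\<mu> m)"
    by (intro nn_integral_cong AB)
  also have "\<dots> = (\<integral>\<^sup>+u. indicator {..y m - s} u * emeasure ?P (B u) \<partial>?\<mu> m)"
    using B_sets by (simp add: nn_integral_cmult)
  also have "\<dots> = (\<integral>\<^sup>+u. indicator {..y m - s} u * emeasure ?P (B u) \<partial>L m)"
    using meas_B id by (intro nn_integral_distr) auto
  also have "\<dots> = (\<integral>\<^sup>+u. ennreal (indicator {..y m - s} u *\<^sub>R measure ?P (B u)) \<partial>L m)"
    unfolding R.emeasure_eq_measure by (intro nn_integral_cong) (simp split: split_indicator)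
  finally have eq: "(\<integral>\<^sup>+u. ennreal (indicator {..y m - s} u *\<^sub>R measure ?P (B u)) \<partial>L m) = ennreal (measure (PiM (insert m ?I) ?\<mu>) A)"
    unfolding Q'.emeasure_eq_measure by (rule sym)
  have "(\<lambda>u. indicator {..y m - s} u *\<^sub>R measure ?P (B u)) \<in> borel_measurable (L m)"
  proof (rule measurable_compose[OF id])
    show "(\<lambda>u. indicator {..y m - s} u *\<^sub>R measure ?P (B u)) \<in> borel_measurable borel"
      using meas_B unfolding measure_def by measurable
  qed
  then have "(LINT u|L m. indicator {..y m - s} u *\<^sub>R measure ?P (B u)) = measure (PiM (insert m ?I) ?\<mu>) A"
    using eq by (subst integral_eq_nn_integral) auto
  then show ?case
    unfolding ins iterated_integral.simps(2) IH set_lebesgue_integral_def s_def[symmetric] A_def[symmetric] .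
qed

section \<open>The counting processes\<close>

text \<open>On an event fixing the increments, this turns the compound sum at the l-th time into a
  partial sum of block sums.\<close>

lemma sum_up_to_partial_sum:
  fixes x :: "nat \<Rightarrow> 'b :: comm_monoid_add" and i :: "nat \<Rightarrow> nat"
  shows "(\<Sum>r=1..(\<Sum>m=1..l. i m). x r) = (\<Sum>p=1..l. \<Sum>r\<in>{(\<Sum>m=1..p - 1. i m)<..(\<Sum>m=1..p. i m)}. x r)"
proof (induction l)
  case (Suc l)
  let ?b = "\<lambda>l. \<Sum>m=1..l. i m"
  have "{1..?b (Suc l)} = {1..?b l} \<union> {?b l<..?b (Suc l)}" by auto
  then have "(\<Sum>r=1..?b (Suc l). x r) = (\<Sum>r=1..?b l. x r) + (\<Sum>r\<in>{?b l<..?b (Suc l)}. x r)"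
    by (simp only:) (rule sum.union_disjoint, auto)
  then show ?case using Suc by simp
qed simp

lemma finite_dim_event_in_gen_sigma:
  fixes n :: nat
  assumes "\<And>l. l \<in> {1..n} \<Longrightarrow> t l \<in> I"
  shows "{\<omega>\<in>space M. \<forall>l\<in>{1..n}. K (t l) \<omega> = c l} \<in> gen_sigma M I (count_space UNIV) K"
proof -
  have "(\<lambda>\<omega>. \<forall>l\<in>{1..n}. K (t l) \<omega> = c l) -` {True} \<inter> space M \<in> gen_sigma M I (count_space UNIV) K"
  proof (rule measurable_vimage_gen_sigma)
    fix S assume *: "\<And>i. i \<in> I \<Longrightarrow> K i \<in> measurable S (count_space UNIV)"
    have [measurable]: "K (t l) \<in> measurable S (count_space UNIV)" if "l \<in> {1..n}" for l
      using assms[OF that] by (rule *)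
    show "(\<lambda>\<omega>. \<forall>l\<in>{1..n}. K (t l) \<omega> = c l) \<in> measurable S (count_space UNIV)"
      by measurable
  qed auto
  also have "(\<lambda>\<omega>. \<forall>l\<in>{1..n}. K (t l) \<omega> = c l) -` {True} \<inter> space M =
      {\<omega>\<in>space M. \<forall>l\<in>{1..n}. K (t l) \<omega> = c l}" by auto
  finally show ?thesis .
qed

text \<open>For \<open>s < t\<close> both sides have the same Poisson law, because
  \<open>N 0 = 0\<close> almost surely. Time points may repeat, and for \<open>s = t\<close> both
  events amount to \<open>i = 0\<close> up to a null set.\<close>

lemma (in prob_space) poisson_process_stationary:
  assumes N: "poisson_process M r N" and st: "0 \<le> s" "s \<le> t"
  shows "prob {\<omega>\<in>space M. N t \<omega> - N s \<omega> = i} = prob {\<omega>\<in>space M. N (t - s) \<omega> = i}"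
proof -
  have [measurable]: "u \<ge> 0 \<Longrightarrow> N u \<in> measurable M (count_space UNIV)" for u
    using N by (auto simp: poisson_process_def)
  have N0: "AE \<omega> in M. N 0 \<omega> = 0"
    using N by (auto simp: poisson_process_def)
  have incr: "prob {\<omega>\<in>space M. N v \<omega> - N u \<omega> = i} = pmf (poisson_pmf (r * (v - u))) i"
    if "0 \<le> u" "u < v" for u v
  proof -
    have "measure (distr M (count_space UNIV) (\<lambda>\<omega>. N v \<omega> - N u \<omega>)) {i} = pmf (poisson_pmf (r * (v - u))) i"
      using N that by (simp add: poisson_process_def measure_pmf_single)
    moreover have "(\<lambda>\<omega>. N v \<omega> - N u \<omega>) -` {i} \<inter> space M = {\<omega>\<in>space M. N v \<omega> - N u \<omega> = i}" by auto
    ultimately show ?thesis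
      using that by (subst (asm) measure_distr) auto
  qed
  show ?thesis
  proof (cases "s = t")
    case True
    show ?thesis
      by (rule measure_eq_AE) (use N0 True st in auto)
  next
    case False
    then have "prob {\<omega>\<in>space M. N t \<omega> - N s \<omega> = i} = prob {\<omega>\<in>space M. N (t - s) \<omega> - N 0 \<omega> = i}"
      using st incr[of s t] incr[of 0 "t - s"] by simp
    also have "\<dots> = prob {\<omega>\<in>space M. N (t - s) \<omega> = i}"
      by (rule measure_eq_AE) (use N0 st in auto)
    finally show ?thesis .
  qed
qed

lemma nonneg_times:
  fixes t :: "nat \<Rightarrow> real"
  assumes "t 0 = 0" and "\<And>l. l \<in> {1..n} \<Longrightarrow> t (l - 1) \<le> t l" and "l \<le> n"
  shows "0 \<le> t l"
  using assms(3)
proof (induction l)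
  case (Suc l)
  then show ?case using assms(2)[of "Suc l"] by simp
qed (use assms in simp)

lemma (in prob_space) poisson_process_increments:
  fixes t :: "nat \<Rightarrow> real"
  assumes N: "poisson_process M r N"
    and t: "t 0 = 0" "\<And>l. l \<in> {1..n} \<Longrightarrow> t (l - 1) \<le> t l" and "n \<ge> 1"
  shows "prob {\<omega>\<in>space M. \<forall>l\<in>{1..n}. N (t l) \<omega> = (\<Sum>m=1..l. i m)} =
         (\<Prod>l=1..n. prob {\<omega>\<in>space M. N (t l - t (l - 1)) \<omega> = i l})"
proof -
  note t0 = nonneg_times[of t n, OF t]
  have [measurable]: "u \<ge> 0 \<Longrightarrow> N u \<in> measurable M (count_space UNIV)" for u
    using N by (auto simp: poisson_process_def)
  have path: "AE \<omega> in M. N 0 \<omega> = 0 \<and> mono_on {0..} (\<lambda>t. N t \<omega>)"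
    using N by (auto simp: poisson_process_def)
  let ?D = "\<lambda>j \<omega>. N (t (Suc j)) \<omega> - N (t j) \<omega>"
  have step: "t j \<le> t (Suc j)" if "j < n" for j
    using t(2)[of "Suc j"] that by simp
  have "indep_vars (\<lambda>_. count_space UNIV) ?D {..<n}"
  proof -
    have "0 \<le> t 0 \<Longrightarrow> \<forall>j<n. t j \<le> t (Suc j) \<Longrightarrow> indep_vars (\<lambda>_. count_space UNIV) ?D {..<n}"
      using N unfolding poisson_process_def by blast
    then show ?thesis using t(1) step by simp
  qed
  then have "prob (\<Inter>j\<in>{..<n}. ?D j -` {i (Suc j)} \<inter> space M) =
      (\<Prod>j<n. prob (?D j -` {i (Suc j)} \<inter> space M))"
    using \<open>n \<ge> 1\<close> by (intro indep_varsD_finite) (auto simp: lessThan_empty_iff)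
  moreover have "?D j -` {i (Suc j)} \<inter> space M = {\<omega>\<in>space M. ?D j \<omega> = i (Suc j)}" for j
    by auto
  ultimately have prod: "prob (\<Inter>j\<in>{..<n}. {\<omega>\<in>space M. ?D j \<omega> = i (Suc j)}) =
      (\<Prod>j<n. prob {\<omega>\<in>space M. ?D j \<omega> = i (Suc j)})"
    by simp
  \<comment> \<open>Cumulative values and truncated differences describe the same event where the
    path starts at 0 and increases, hence almost surely.\<close>
  have "prob {\<omega>\<in>space M. \<forall>l\<in>{1..n}. N (t l) \<omega> = (\<Sum>m=1..l. i m)} =
      prob (\<Inter>j\<in>{..<n}. {\<omega>\<in>space M. ?D j \<omega> = i (Suc j)})"
  proof (rule measure_eq_AE)
    show "AE \<omega> in M. \<omega> \<in> {\<omega>\<in>space M. \<forall>l\<in>{1..n}. N (t l) \<omega> = (\<Sum>m=1..l. i m)} \<longleftrightarrow>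
        \<omega> \<in> (\<Inter>j\<in>{..<n}. {\<omega>\<in>space M. ?D j \<omega> = i (Suc j)})"
      using path AE_space
    proof eventually_elim
      case (elim \<omega>)
      define d where "d l = N (t l) \<omega> - N (t (l - 1)) \<omega>" for l
      have "l \<le> n \<Longrightarrow> N (t l) \<omega> = (\<Sum>m=1..l. d m)" for l
      proof (induction l)
        case (Suc l)
        then have "N (t l) \<omega> \<le> N (t (Suc l)) \<omega>"
          using mono_onD[of "{0..}" "\<lambda>t. N t \<omega>" "t l" "t (Suc l)"] elim(1) step[of l] t0[of l] t0[of "Suc l"]
          by auto
        with Suc show ?case by (simp add: d_def)
      qed (use elim t in simp)
      then have "(\<forall>l\<in>{1..n}. N (t l) \<omega> = (\<Sum>m=1..l. i m)) \<longleftrightarrow>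
          (\<forall>l\<in>{1..n}. (\<Sum>m=1..l. d m) = (\<Sum>m=1..l. i m))"
        by auto
      also have "\<dots> \<longleftrightarrow> (\<forall>l\<in>{1..n}. d l = i l)"
        by (rule partial_sums_eq_iff)
      \<comment> \<open>Increments are indexed from 0 in \<open>poisson_process\<close> and from 1
        here.\<close>
      also have "\<dots> \<longleftrightarrow> (\<forall>j<n. d (Suc j) = i (Suc j))"
        unfolding image_Suc_lessThan[symmetric] by auto
      finally show ?case using elim(2) \<open>n \<ge> 1\<close> by (auto simp: d_def)
    qed
    show "{\<omega>\<in>space M. \<forall>l\<in>{1..n}. N (t l) \<omega> = (\<Sum>m=1..l. i m)} \<in> events"
    proof -
      have [measurable]: "N (t l) \<in> measurable M (count_space UNIV)" if "l \<in> {1..n}" for l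
        using that t0 by auto
      show ?thesis by measurable
    qed
    show "(\<Inter>j\<in>{..<n}. {\<omega>\<in>space M. ?D j \<omega> = i (Suc j)}) \<in> events"
    proof (rule sets.finite_INT)
      fix j assume "j \<in> {..<n}"
      then have [measurable]: "N (t j) \<in> measurable M (count_space UNIV)" "N (t (Suc j)) \<in> measurable M (count_space UNIV)"
        using t0 by auto
      show "{\<omega>\<in>space M. ?D j \<omega> = i (Suc j)} \<in> events" by measurable
    qed (use \<open>n \<ge> 1\<close> in \<open>auto simp: lessThan_empty_iff\<close>)
  qed
  also have "\<dots> = (\<Prod>j<n. prob {\<omega>\<in>space M. N (t (Suc j) - t j) \<omega> = i (Suc j)})"
    unfolding prod using t0 step by (intro prod.cong poisson_process_stationary[OF N]) auto
  also have "\<dots> = (\<Prod>l=1..n. prob {\<omega>\<in>space M. N (t l - t (l - 1)) \<omega> = i l})"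
    by (simp add: prod.atLeast1_atMost_eq)
  finally show ?thesis .
qed

text \<open>Every set of natural numbers is Borel, so the rule for Borel measurable sums carries
  over.\<close>

lemma measurable_sum_nat:
  fixes X :: "'i \<Rightarrow> 'a \<Rightarrow> nat"
  assumes "\<And>i. i \<in> I \<Longrightarrow> X i \<in> measurable M (count_space UNIV)"
  shows "(\<lambda>\<omega>. \<Sum>i\<in>I. X i \<omega>) \<in> measurable M (count_space UNIV)"
proof -
  have eq: "measurable M (borel :: nat measure) = measurable M (count_space UNIV)"
    by (rule measurable_cong_sets) (auto simp: sets_borel_eq_count_space)
  show ?thesis
    using borel_measurable_sum[of I X M] assms unfolding eq by blast
qed

section \<open>The Poisson process of order k and the laws of the convolution powers\<close>

context prob_space
begin

lemma PPoK_path: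
  assumes "PPoK M k lam Nk"
  shows PPoK_measurable: "t \<ge> 0 \<Longrightarrow> Nk t \<in> measurable M (count_space UNIV)"
    and PPoK_AE_mono: "AE \<omega> in M. Nk 0 \<omega> = 0 \<and> mono_on {0..} (\<lambda>t. Nk t \<omega>)"
proof -
  obtain N and X :: "nat \<Rightarrow> 'a \<Rightarrow> nat" where N: "poisson_process M (real k * lam) N"
    and X: "indep_vars (\<lambda>_. count_space UNIV) X {1..}"
    and Nk: "\<forall>t\<ge>0. \<forall>\<omega>\<in>space M. Nk t \<omega> = (\<Sum>i=1..N t \<omega>. X i \<omega>)"
    using assms unfolding PPoK_def by blast
  have [measurable]: "i \<ge> 1 \<Longrightarrow> X i \<in> measurable M (count_space UNIV)" for i
    using X by (auto simp: indep_vars_def)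
  have [measurable]: "t \<ge> 0 \<Longrightarrow> N t \<in> measurable M (count_space UNIV)" for t
    using N by (auto simp: poisson_process_def)
  show "Nk t \<in> measurable M (count_space UNIV)" if "t \<ge> 0"
  proof -
    \<comment> \<open>The random upper limit takes countably many values, so fixed limits
      suffice.\<close>
    have "(\<lambda>\<omega>. \<Sum>i=1..N t \<omega>. X i \<omega>) \<in> measurable M (count_space UNIV)"
      using that by (intro measurable_compose_countable[where f = "\<lambda>n \<omega>. \<Sum>i=1..n. X i \<omega>" and g = "N t"] measurable_sum_nat) auto
    then show ?thesis
      using Nk that by (subst measurable_cong) auto
  qed
  have "AE \<omega> in M. N 0 \<omega> = 0 \<and> mono_on {0..} (\<lambda>t. N t \<omega>)"
    using N by (auto simp: poisson_process_def)
  then show "AE \<omega> in M. Nk 0 \<omega> = 0 \<and> mono_on {0..} (\<lambda>t. Nk t \<omega>)"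
    using AE_space
  proof eventually_elim
    case (elim \<omega>)
    \<comment> \<open>The jumps \<open>X i\<close> are natural numbers, so a longer sum is at least
      as large.\<close>
    have "Nk s \<omega> \<le> Nk t \<omega>" if "0 \<le> s" "s \<le> t" for s t
    proof -
      have "N s \<omega> \<le> N t \<omega>"
        using mono_onD[of "{0..}" "\<lambda>t. N t \<omega>" s t] elim that by auto
      then show ?thesis
        using Nk elim that by (auto intro!: sum_mono2)
    qed
    then show ?case
      using Nk elim by (auto intro!: mono_onI)
  qed
qed

text \<open>Conditioning on the increments of \<open>N\<close> writes the law of the increments of \<open>Nk\<close> as a sum over
  \<open>\<nat>\<^sup>n\<close> of product weights, hence as a product; the case \<open>n = 1\<close> identifies the factors.\<close>

lemma PPoK_increments:
  fixes t :: "nat \<Rightarrow> real"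
  assumes "PPoK M k lam Nk"
    and t: "t 0 = 0" "\<And>l. l \<in> {1..n} \<Longrightarrow> t (l - 1) \<le> t l" and "n \<ge> 1"
  shows "prob {\<omega>\<in>space M. \<forall>l\<in>{1..n}. Nk (t l) \<omega> = (\<Sum>m=1..l. j m)} =
         (\<Prod>l=1..n. prob {\<omega>\<in>space M. Nk (t l - t (l - 1)) \<omega> = j l})"
proof -
  obtain N and X :: "nat \<Rightarrow> 'a \<Rightarrow> nat" where N: "poisson_process M (real k * lam) N"
    and X: "indep_vars (\<lambda>_. count_space UNIV) X {1..}"
    and lawX: "\<forall>i\<ge>1. distr M (count_space UNIV) (X i) = measure_pmf (pmf_of_set {1..k})"
    and indep: "indep_set (gen_sigma M {0..} (count_space UNIV) N) (gen_sigma M {1..} (count_space UNIV) X)"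
    and Nk: "\<forall>t\<ge>0. \<forall>\<omega>\<in>space M. Nk t \<omega> = (\<Sum>i=1..N t \<omega>. X i \<omega>)"
    using assms(1) unfolding PPoK_def by blast
  \<comment> \<open>The block lemmas concern real variables; embedding the jumps preserves equality
    of their sums.\<close>
  define X' where "X' i \<omega> = real (X i \<omega>)" for i \<omega>
  have rvX: "i \<ge> 1 \<Longrightarrow> X i \<in> measurable M (count_space UNIV)" for i
    using X by (auto simp: indep_vars_def)
  have rvN: "u \<ge> 0 \<Longrightarrow> N u \<in> measurable M (count_space UNIV)" for u
    using N by (auto simp: poisson_process_def)
  note rvNk = PPoK_measurable[OF assms(1)]
  have path: "AE \<omega> in M. N 0 \<omega> = 0 \<and> mono_on {0..} (\<lambda>t. N t \<omega>)"
    using N by (auto simp: poisson_process_def)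
  have X': "indep_vars (\<lambda>_. borel) X' {1..}"
    unfolding X'_def by (rule indep_vars_compose2[OF X, where Y = "\<lambda>_. real"]) simp
  then have rvX': "i \<ge> 1 \<Longrightarrow> X' i \<in> borel_measurable M" for i
    by (auto simp: indep_vars_def)
  have lawX': "distr M borel (X' i) = distr (measure_pmf (pmf_of_set {1..k})) borel real" if "i \<ge> 1" for i
  proof -
    have "distr M borel (X' i) = distr (distr M (count_space UNIV) (X i)) borel real"
      using rvX[OF that] by (subst distr_distr) (auto simp: X'_def[abs_def] comp_def)
    then show ?thesis using lawX that by simp
  qed
  have indep': "indep_set (gen_sigma M {0..} (count_space UNIV) N) (gen_sigma M {1..} borel X')"
  proof -
    have "gen_sigma M {1..} borel X' \<subseteq> gen_sigma M {1..} (count_space UNIV) X"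
    proof (rule gen_sigma_mono)
      fix i and A :: "real set"
      have "X' i -` A \<inter> space M = X i -` (real -` A) \<inter> space M" by (auto simp: X'_def)
      then show "\<exists>B\<in>sets (count_space UNIV). X' i -` A \<inter> space M = X i -` B \<inter> space M" by auto
    qed
    then show ?thesis using indep unfolding indep_sets2_eq by blast
  qed
  define S where "S i = distr M borel (\<lambda>\<omega>. \<Sum>r=1..i. X' r \<omega>)" for i
  interpret S: prob_space "S i" for i
    unfolding S_def using rvX' by (intro prob_space_distr borel_measurable_sum) auto
  \<comment> \<open>Times and targets are quantified anew because the identity is applied both to
    the given times and to a single interval. The laws \<open>S i\<close> stay unevaluated.\<close>
  have core: "emeasure M {\<omega>\<in>space M. \<forall>l\<in>{1..n}. Nk (t l) \<omega> = (\<Sum>m=1..l. j m)} =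
      (\<Prod>l=1..n. \<integral>\<^sup>+i. ennreal (prob {\<omega>\<in>space M. N (t l - t (l - 1)) \<omega> = i}) * emeasure (S i) {real (j l)} \<partial>count_space UNIV)"
    if t: "t 0 = 0" "\<And>l. l \<in> {1..n} \<Longrightarrow> t (l - 1) \<le> t l" and n: "n \<ge> 1"
    for n j and t :: "nat \<Rightarrow> real"
  proof -
    note t0 = nonneg_times[of t n, OF t]
    let ?Q = "{\<omega>\<in>space M. \<forall>l\<in>{1..n}. Nk (t l) \<omega> = (\<Sum>m=1..l. j m)}"
    let ?E = "\<lambda>i. {\<omega>\<in>space M. \<forall>l\<in>{1..n}. N (t l) \<omega> = (\<Sum>m=1..l. i m)}"
    let ?b = "\<lambda>i l. \<Sum>m=1..l. i m :: nat"
    have Q: "?Q \<in> events"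
    proof -
      have [measurable]: "Nk (t l) \<in> measurable M (count_space UNIV)" if "l \<in> {1..n}" for l
        using that t0 by (intro rvNk) auto
      show ?thesis by measurable
    qed
    define A where "A = PiE {1..n} (\<lambda>l. {real (j l)})"
    define D where "D i = {\<omega>\<in>space M. (\<lambda>l\<in>{1..n}. \<Sum>r\<in>{?b i (l - 1)<..?b i l}. X' r \<omega>) \<in> A}" for i
    have A: "A \<in> sets (PiM {1..n} (\<lambda>_. borel))"
      unfolding A_def by (rule sets_PiM_I_finite) auto
    \<comment> \<open>On \<open>?E i\<close> the blocks are known, and prescribing the values of
      \<open>Nk\<close> amounts to prescribing the block sums.\<close>
    have split: "?Q \<inter> ?E i = ?E i \<inter> D i" for i
    proof -
      have "\<omega> \<in> ?Q \<longleftrightarrow> \<omega> \<in> D i" if \<omega>: "\<omega> \<in> ?E i" for \<omega>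
      proof -
        have "Nk (t l) \<omega> = (\<Sum>p=1..l. \<Sum>r\<in>{?b i (p - 1)<..?b i p}. X r \<omega>)" if "l \<in> {1..n}" for l
          using Nk t0[of l] \<omega> that sum_up_to_partial_sum[of "\<lambda>r. X r \<omega>" i l] by auto
        then have "\<omega> \<in> ?Q \<longleftrightarrow>
            (\<forall>l\<in>{1..n}. (\<Sum>p=1..l. \<Sum>r\<in>{?b i (p - 1)<..?b i p}. X r \<omega>) = (\<Sum>m=1..l. j m))"
          using \<omega> by auto
        also have "\<dots> \<longleftrightarrow> (\<forall>l\<in>{1..n}. (\<Sum>r\<in>{?b i (l - 1)<..?b i l}. X r \<omega>) = j l)"
          by (rule partial_sums_eq_iff)
        also have "\<dots> \<longleftrightarrow> (\<forall>l\<in>{1..n}. (\<Sum>r\<in>{?b i (l - 1)<..?b i l}. X' r \<omega>) = real (j l))"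
          unfolding X'_def of_nat_sum[symmetric] of_nat_eq_iff ..
        also have "\<dots> \<longleftrightarrow> \<omega> \<in> D i"
          using \<omega> by (auto simp: D_def A_def PiE_iff)
        finally show ?thesis .
      qed
      then show ?thesis by blast
    qed
    have "emeasure M (?E i \<inter> D i) =
        (\<Prod>l=1..n. ennreal (prob {\<omega>\<in>space M. N (t l - t (l - 1)) \<omega> = i l}) * emeasure (S (i l)) {real (j l)})" for i
    proof -
      interpret P: product_prob_space "\<lambda>l. S (i l)" "{1..n}"
        by (intro product_prob_spaceI S.prob_space_axioms)
      have "?E i \<in> gen_sigma M {0..} (count_space UNIV) N"
        using t0 by (intro finite_dim_event_in_gen_sigma) auto
      from emeasure_indep_block_sums[OF X' lawX' indep' this A n, of i]
      have "emeasure M (?E i \<inter> D i) = emeasure M (?E i) * emeasure (PiM {1..n} (\<lambda>l. S (i l))) A"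
        unfolding D_def S_def .
      also have "emeasure (PiM {1..n} (\<lambda>l. S (i l))) A = (\<Prod>l=1..n. emeasure (S (i l)) {real (j l)})"
        unfolding A_def by (rule P.emeasure_PiM) (auto simp: S_def)
      also have "emeasure M (?E i) = (\<Prod>l=1..n. ennreal (prob {\<omega>\<in>space M. N (t l - t (l - 1)) \<omega> = i l}))"
        unfolding emeasure_eq_measure using poisson_process_increments[OF N t n, of i]
        by (simp add: prod_ennreal)
      finally show ?thesis by (simp add: prod.distrib)
    qed
    then have "emeasure M ?Q = (\<integral>\<^sup>+i. (\<Prod>l=1..n. ennreal (prob {\<omega>\<in>space M. N (t l - t (l - 1)) \<omega> = i l}) *
        emeasure (S (i l)) {real (j l)}) \<partial>count_space ({1..n} \<rightarrow>\<^sub>E UNIV))"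
      unfolding split[symmetric]
    proof (subst emeasure_split_increments[where K = "\<lambda>l. N (t l)" and n = n, OF _ _ Q])
      show "AE \<omega> in M. N (t 0) \<omega> = 0 \<and> (\<forall>l\<in>{1..n}. N (t (l - 1)) \<omega> \<le> N (t l) \<omega>)"
        using path
      proof eventually_elim
        case (elim \<omega>)
        then show ?case using t t0 by (auto intro!: mono_onD[of "{0..}" "\<lambda>t. N t \<omega>"])
      qed
    qed (use t0 rvN in simp_all)
    \<comment> \<open>Counting measure on these functions is a product of counting measures, so the
      sum over multi-indices factors into one-dimensional sums.\<close>
    also have "\<dots> = (\<integral>\<^sup>+i. (\<Prod>l=1..n. ennreal (prob {\<omega>\<in>space M. N (t l - t (l - 1)) \<omega> = i l}) *
        emeasure (S (i l)) {real (j l)}) \<partial>PiM {1..n} (\<lambda>_. count_space UNIV))"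
      by (subst count_space_PiM_finite) auto
    also have "\<dots> = (\<Prod>l=1..n. \<integral>\<^sup>+i. ennreal (prob {\<omega>\<in>space M. N (t l - t (l - 1)) \<omega> = i}) *
        emeasure (S i) {real (j l)} \<partial>count_space UNIV)"
    proof -
      interpret product_sigma_finite "\<lambda>_::nat. count_space (UNIV :: nat set)"
        by (simp add: product_sigma_finite_def sigma_finite_measure_count_space)
      show ?thesis
        by (rule product_nn_integral_prod[where
              f = "\<lambda>l i. ennreal (prob {\<omega>\<in>space M. N (t l - t (l - 1)) \<omega> = i}) * emeasure (S i) {real (j l)}"]) auto
    qed
    finally show ?thesis .
  qed
  \<comment> \<open>One interval from 0 to \<open>s\<close>: with time 0 at index 0 and
    \<open>s\<close> at index 1, the only increment has length \<open>s\<close>.\<close>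
  have single: "emeasure M {\<omega>\<in>space M. Nk s \<omega> = v} =
      (\<integral>\<^sup>+i. ennreal (prob {\<omega>\<in>space M. N s \<omega> = i}) * emeasure (S i) {real v} \<partial>count_space UNIV)"
    if "s \<ge> 0" for s v
    using core[of "\<lambda>l. if l = 0 then 0 else s" 1 "\<lambda>_. v"] that by simp
  have "ennreal (prob {\<omega>\<in>space M. \<forall>l\<in>{1..n}. Nk (t l) \<omega> = (\<Sum>m=1..l. j m)}) =
      (\<Prod>l=1..n. emeasure M {\<omega>\<in>space M. Nk (t l - t (l - 1)) \<omega> = j l})"
    using core[OF t \<open>n \<ge> 1\<close>, of j] single t(2) by (simp add: emeasure_eq_measure[symmetric])
  also have "\<dots> = ennreal (\<Prod>l=1..n. prob {\<omega>\<in>space M. Nk (t l - t (l - 1)) \<omega> = j l})"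
    by (simp add: emeasure_eq_measure prod_ennreal)
  finally show ?thesis
    by (simp add: prod_nonneg)
qed

text \<open>Powers 0 and 1 are both base cases: the Dirac mass is the law of the empty sum, and
  \<open>h\<close> gives the law of one variable. Beyond them both sides follow the same convolution
  recursion.\<close>

lemma distr_conv_measure_eq_distr_sum:
  fixes Y :: "nat \<Rightarrow> 'a \<Rightarrow> real"
  assumes \<nu>: "\<nu> = lborel \<or> \<nu> = count_space UNIV" and h: "has_density_wrt \<nu> H h"
    and Y: "indep_vars (\<lambda>_. borel) Y {1..}"
    and H: "\<And>i. i \<ge> 1 \<Longrightarrow> cdf (distr M borel (Y i)) = H"
  shows "distr (conv_measure \<nu> h j) borel (\<lambda>x. x) = distr M borel (\<lambda>\<omega>. \<Sum>r=1..j. Y r \<omega>)"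
proof -
  have rv: "i \<ge> 1 \<Longrightarrow> Y i \<in> borel_measurable M" for i
    using Y by (auto simp: indep_vars_def)
  have law: "distr (density \<nu> (\<lambda>x. ennreal (h x))) borel (\<lambda>x. x) = distr M borel (Y i)" if "i \<ge> 1" for i
    using has_density_wrt_distr[OF \<nu>, of "distr M borel (Y i)" h] h H[OF that] rv[OF that] by simp
  have fin: "finite_measure (distr M borel (\<lambda>\<omega>. \<Sum>r=1..j. Y r \<omega>))" for j
    using rv by (intro finite_measure_distr borel_measurable_sum) auto
  show ?thesis
  proof (induction j)
    case 0
    show ?case by (simp only: distr_conv_measure_0[OF \<nu>]) (simp add: distr_const)
  next
    case (Suc j)
    show ?case
    proof (cases j)
      case 0
      then show ?thesis using law[of 1] by simp
    next
      case (Suc j')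
      have "distr (conv_measure \<nu> h (Suc (Suc j'))) borel (\<lambda>x. x) =
          convolution (distr M borel (\<lambda>\<omega>. \<Sum>r=1..j. Y r \<omega>)) (distr M borel (Y 1))"
        using distr_conv_measure_Suc[OF \<nu>, of h j'] h fin[of j] fin[of 1] law[of 1] Suc.IH Suc
        by (simp add: has_density_wrt_def)
      also have "\<dots> = distr M borel (\<lambda>\<omega>. \<Sum>r=1..Suc j. Y r \<omega>)"
        using distr_sum_block_Suc[OF Y law[symmetric], of 0 j] law[of 1]
        by (simp add: atLeastSucAtMost_greaterThanAtMost)
      finally show ?thesis by (simp only: Suc)
    qed
  qed
qed

end

section \<open>Finite-dimensional distributions of the compound process\<close>

theorem theorem2p1:
  fixes M :: "'a measure" and k n :: nat and lam :: real and H h :: "real \<Rightarrow> real"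
    and \<nu> :: "real measure"
    and Nk :: "real \<Rightarrow> 'a \<Rightarrow> nat" and Y :: "nat \<Rightarrow> 'a \<Rightarrow> real" and Z :: "real \<Rightarrow> 'a \<Rightarrow> real"
    and t y :: "nat \<Rightarrow> real"
  assumes "prob_space M"
    and "k \<ge> 1" and "lam > 0"
    and "CPPoK M k lam H Nk Y Z"
    and "\<nu> = lborel \<or> \<nu> = count_space UNIV"
    and "has_density_wrt \<nu> H h"
    and "n \<ge> 1" and "t 0 = 0" and "\<And>l. l \<in> {1..n} \<Longrightarrow> t (l - 1) \<le> t l"
  shows "((\<lambda>j :: nat \<Rightarrow> nat.
            (\<Prod>l=1..n. \<P>(\<omega> in M. Nk (t l - t (l - 1)) \<omega> = j l)) *
            iterated_integral (\<lambda>m. conv_measure \<nu> h (j m)) (\<lambda>m x. y m - (\<Sum>l=1..<m. x l)) n 1 (\<lambda>_. 0))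
          has_sum \<P>(\<omega> in M. \<forall>l\<in>{1..n}. Z (t l) \<omega> \<le> y l))
         ({1..n} \<rightarrow>\<^sub>E UNIV)"
proof -
  interpret prob_space M by fact
  note \<nu> = assms(5) and n = \<open>n \<ge> 1\<close> and t = assms(8,9)
  note t0 = nonneg_times[of t n, OF t]
  have Nk: "PPoK M k lam Nk" and Y: "indep_vars (\<lambda>_. borel) Y {1..}"
    and H: "\<And>i. i \<ge> 1 \<Longrightarrow> cdf (distr M borel (Y i)) = H"
    and indep: "indep_set (gen_sigma M {0..} (count_space UNIV) Nk) (gen_sigma M {1..} borel Y)"
    and Z: "\<And>t \<omega>. t \<ge> 0 \<Longrightarrow> \<omega> \<in> space M \<Longrightarrow> Z t \<omega> = (\<Sum>i=1..Nk t \<omega>. Y i \<omega>)"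
    using assms(4) unfolding CPPoK_def by auto
  note rvNk = PPoK_measurable[OF Nk]
  have rvY: "i \<ge> 1 \<Longrightarrow> Y i \<in> borel_measurable M" for i
    using Y by (auto simp: indep_vars_def)
  have rvZ: "Z s \<in> borel_measurable M" if "s \<ge> 0" for s
  proof -
    have "(\<lambda>\<omega>. \<Sum>i=1..Nk s \<omega>. Y i \<omega>) \<in> borel_measurable M"
      using that by (intro measurable_compose_countable[where f = "\<lambda>n \<omega>. \<Sum>i=1..n. Y i \<omega>" and g = "Nk s"]
          borel_measurable_sum rvY rvNk) auto
    then show ?thesis using Z that by (subst measurable_cong) auto
  qed
  define \<mu> where "\<mu> j = distr M borel (\<lambda>\<omega>. \<Sum>r=1..j. Y r \<omega>)" for j
  have \<mu>: "distr (conv_measure \<nu> h j) borel (\<lambda>x. x) = \<mu> j" for j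
    unfolding \<mu>_def by (rule distr_conv_measure_eq_distr_sum[OF \<nu> assms(6) Y H])
  \<comment> \<open>Equal distribution functions supply the common marginal law for the block
    argument, represented by \<open>\<mu> 1\<close>, the law of \<open>Y 1\<close>.\<close>
  have law: "distr M borel (Y i) = \<mu> 1" if "i \<ge> 1" for i
  proof (rule cdf_unique)
    show "cdf (distr M borel (Y i)) = cdf (\<mu> 1)" using H that by (simp add: \<mu>_def)
  qed (use rvY that in \<open>auto simp: \<mu>_def\<close>)
  have prob_\<mu>: "prob_space (\<mu> j)" for j
    unfolding \<mu>_def using rvY by (intro prob_space_distr borel_measurable_sum) auto
  have id: "(\<lambda>x. x) \<in> measurable (conv_measure \<nu> h j) borel" for j
    using \<nu> by (cases j) auto
  let ?p = "\<lambda>j. \<Prod>l=1..n. \<P>(\<omega> in M. Nk (t l - t (l - 1)) \<omega> = j l)"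
  let ?J = "\<lambda>j. iterated_integral (\<lambda>m. conv_measure \<nu> h (j m)) (\<lambda>m x. y m - (\<Sum>l=1..<m. x l)) n 1 (\<lambda>_. 0)"
  let ?Q = "{\<omega>\<in>space M. \<forall>l\<in>{1..n}. Z (t l) \<omega> \<le> y l}"
  let ?E = "\<lambda>j. {\<omega>\<in>space M. \<forall>l\<in>{1..n}. Nk (t l) \<omega> = (\<Sum>m=1..l. j m)}"
  let ?b = "\<lambda>j l. \<Sum>m=1..l. j m :: nat"
  have Q: "?Q \<in> events"
  proof -
    have [measurable]: "Z (t l) \<in> borel_measurable M" if "l \<in> {1..n}" for l
      using that t0 by (intro rvZ) auto
    show ?thesis by measurable
  qed
  \<comment> \<open>One set serves both sides: it is the region of the iterated integral and,
    evaluated at block sums, the event that every \<open>Z (t l) \<le> y l\<close>.\<close>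
  define A where "A = {w \<in> space (PiM {1..n} (\<lambda>_. borel)). \<forall>l\<in>{1..n}. (\<Sum>p=1..l. w p) \<le> y l}"
  have A: "A \<in> sets (PiM {1..n} (\<lambda>_. borel))"
  proof -
    have "A = {w \<in> space (PiM {1..n} (\<lambda>_. borel)). \<forall>l\<in>{1..n}. (\<Sum>p\<in>{1..l} \<inter> {1..n}. w p) \<le> y l}"
      unfolding A_def by (intro Collect_cong conj_cong refl ball_cong arg_cong2[where f="(\<le>)"] sum.cong) auto
    then show ?thesis by simp
  qed
  \<comment> \<open>At index 1 the prefix sum is empty, so the initial function
    \<open>\<lambda>_. 0\<close> is only a default.\<close>
  have J: "?J j = measure (PiM {1..n} (\<lambda>l. \<mu> (j l))) A" for j
    using iterated_integral_eq_measure_PiM[of "\<lambda>m. conv_measure \<nu> h (j m)" 1 y n "\<lambda>_. 0"] id prob_\<mu>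
    by (simp add: \<mu> A_def atLeastLessThanSuc_atLeastAtMost)
  define D where "D j = {\<omega>\<in>space M. (\<lambda>l\<in>{1..n}. \<Sum>r\<in>{?b j (l - 1)<..?b j l}. Y r \<omega>) \<in> A}" for j
  have split: "?Q \<inter> ?E j = ?E j \<inter> D j" for j
  proof -
    have "\<omega> \<in> ?Q \<longleftrightarrow> \<omega> \<in> D j" if \<omega>: "\<omega> \<in> ?E j" for \<omega>
    proof -
      let ?W = "\<lambda>l. \<Sum>r\<in>{?b j (l - 1)<..?b j l}. Y r \<omega>"
      have "Z (t l) \<omega> = (\<Sum>p=1..l. (\<lambda>l\<in>{1..n}. ?W l) p)" if "l \<in> {1..n}" for l
      proof -
        have "Z (t l) \<omega> = (\<Sum>p=1..l. ?W p)"
          using Z[of "t l" \<omega>] t0[of l] \<omega> that sum_up_to_partial_sum[of "\<lambda>r. Y r \<omega>" j l] by auto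
        also have "\<dots> = (\<Sum>p=1..l. (\<lambda>l\<in>{1..n}. ?W l) p)"
          using that by (intro sum.cong) auto
        finally show ?thesis .
      qed
      then show ?thesis using \<omega> by (auto simp: D_def A_def space_PiM)
    qed
    then show ?thesis by blast
  qed
  \<comment> \<open>Independence of \<open>Nk\<close> and \<open>Y\<close> gives a product; the
    independent stationary increments of \<open>Nk\<close> turn the probability of
    \<open>?E j\<close> into \<open>?p j\<close>.\<close>
  have summand: "emeasure M (?Q \<inter> ?E j) = ennreal (?p j * ?J j)" for j
  proof -
    interpret P: prob_space "PiM {1..n} (\<lambda>l. \<mu> (j l))"
      by (intro prob_space_PiM prob_\<mu>)
    have "?E j \<in> gen_sigma M {0..} (count_space UNIV) Nk"
      using t0 by (intro finite_dim_event_in_gen_sigma) auto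
    from emeasure_indep_block_sums[OF Y law indep this A n, of j]
    have "emeasure M (?E j \<inter> D j) = emeasure M (?E j) * emeasure (PiM {1..n} (\<lambda>l. \<mu> (j l))) A"
      unfolding D_def \<mu>_def .
    then have "emeasure M (?Q \<inter> ?E j) = ennreal (prob (?E j) * ?J j)"
      unfolding split J P.emeasure_eq_measure emeasure_eq_measure by (simp add: ennreal_mult'')
    then show ?thesis
      using PPoK_increments[OF Nk t n, of j] by (simp only:)
  qed
  have "emeasure M ?Q = (\<integral>\<^sup>+j. emeasure M (?Q \<inter> ?E j) \<partial>count_space ({1..n} \<rightarrow>\<^sub>E UNIV))"
  proof (rule emeasure_split_increments[where K = "\<lambda>l. Nk (t l)", OF _ _ Q])
    show "AE \<omega> in M. Nk (t 0) \<omega> = 0 \<and> (\<forall>l\<in>{1..n}. Nk (t (l - 1)) \<omega> \<le> Nk (t l) \<omega>)"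
      using PPoK_AE_mono[OF Nk]
    proof eventually_elim
      case (elim \<omega>)
      then show ?case using t t0 by (auto intro!: mono_onD[of "{0..}" "\<lambda>t. Nk t \<omega>"])
    qed
  qed (use t0 rvNk in simp)
  \<comment> \<open>The total is a probability, hence finite, so the integral of nonnegative terms
    converts to \<open>has_sum\<close>.\<close>
  then have "(\<integral>\<^sup>+j. ennreal (?p j * ?J j) \<partial>count_space ({1..n} \<rightarrow>\<^sub>E UNIV)) = ennreal (prob ?Q)"
    unfolding summand by (simp add: emeasure_eq_measure)
  then show ?thesis
    by (rule has_sum_nn_integral_count_space) (simp_all only: J, auto intro!: mult_nonneg_nonneg prod_nonneg)
qed

end
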